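(* For every finite simple graph $G$ on $n$ vertices, $\alpha_{1}(G) + \tau_{B}(G) \le \frac{3 n^2}{10}$.
   Context: All graphs are finite, simple and undirected. A triangle-independent set in $G$ is a set of edges containing at most one edge from each triangle of $G$; $\alpha_{1}(G)$ denotes the maximum size of a triangle-independent set in $G$. $\tau_{B}(G)$ denotes the minimum size of a set of edges whose deletion from $G$ leaves a bipartite graph. *)

theory Defs
  imports Complex_Main "HOL-Library.Ramsey"
begin

definition simple_graph :: "'a set \<Rightarrow> 'a set set \<Rightarrow> bool" where
  "simple_graph V E \<longleftrightarrow> finite V \<and> E \<subseteq> nsets V 2"

(* A triangle is represented by its set of three edges. *)
definition triangles :: "'a set set \<Rightarrow> 'a set set set" where
  "triangles E = {{{x, y}, {y, z}, {x, z}} | x y z.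
     distinct [x, y, z] \<and> {x, y} \<in> E \<and> {y, z} \<in> E \<and> {x, z} \<in> E}"

definition triangle_independent :: "'a set set \<Rightarrow> 'a set set \<Rightarrow> bool" where
  "triangle_independent E A \<longleftrightarrow> A \<subseteq> E \<and> (\<forall>T\<in>triangles E. card (A \<inter> T) \<le> 1)"

definition alpha_1 :: "'a set set \<Rightarrow> nat" where
  "alpha_1 E = Max {card A | A. triangle_independent E A}"

definition bipartite :: "'a set \<Rightarrow> 'a set set \<Rightarrow> bool" where
  "bipartite V E \<longleftrightarrow>
     (\<exists>X Y. X \<union> Y = V \<and> X \<inter> Y = {} \<and> (\<forall>e\<in>E. \<exists>x\<in>X. \<exists>y\<in>Y. e = {x, y}))"

definition tau_B :: "'a set \<Rightarrow> 'a set set \<Rightarrow> nat" where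
  "tau_B V E = Min {card D | D. D \<subseteq> E \<and> bipartite V (E - D)}"

lemma simple_graph_finite_edges:
  assumes "simple_graph V E"
  shows "finite E"
  using assms finite_imp_finite_nsets finite_subset unfolding simple_graph_def by blast

(* The maximum and the minimum above range over finite nonempty sets. *)

lemma alpha_1_attained:
  assumes "finite E"
  shows "finite {card A | A. triangle_independent E A}"
    and "{card A | A. triangle_independent E A} \<noteq> {}"
proof -
  have "{card A | A. triangle_independent E A} \<subseteq> card ` Pow E"
    by (auto simp: triangle_independent_def)
  then show "finite {card A | A. triangle_independent E A}"
    using assms finite_subset by blast
  have "triangle_independent E {}"
    by (simp add: triangle_independent_def)
  then show "{card A | A. triangle_independent E A} \<noteq> {}"
    by blast
qed

lemma tau_B_attained:
  assumes "finite E"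
  shows "finite {card D | D. D \<subseteq> E \<and> bipartite V (E - D)}"
    and "{card D | D. D \<subseteq> E \<and> bipartite V (E - D)} \<noteq> {}"
proof -
  have "{card D | D. D \<subseteq> E \<and> bipartite V (E - D)} \<subseteq> card ` Pow E"
    by auto
  then show "finite {card D | D. D \<subseteq> E \<and> bipartite V (E - D)}"
    using assms finite_subset by blast
  have "bipartite V (E - E)"
    by (auto simp: bipartite_def)
  then show "{card D | D. D \<subseteq> E \<and> bipartite V (E - D)} \<noteq> {}"
    by blast
qed

end

theory Submission
  imports Defs
begin

text \<open>
  Blowing up vertices replaces the graph by a vertex-weighted one, whose total weight \<open>N\<close> may be
  taken large, so that an error linear in \<open>N\<close> is harmless. Let \<open>g\<close> and \<open>h\<close> be the weighted
  degrees in the graph and in the triangle-independent set \<open>F\<close>. If some vertex satisfies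
  \<open>h + g / 2 \<le> 3 N / 5\<close>, remove one unit of its weight and induct. Otherwise use that
  \<open>F\<close>-neighbourhoods are independent sets and that \<open>g v + h x \<le> N\<close> along every edge of \<open>F\<close>:
  put the \<open>F\<close>-neighbours of a vertex on one side, place each of the other vertices on that
  side with probability \<open>1 / 6\<close>, and average over the chosen vertex.
\<close>

section \<open>Quadratic forms in vertex weights\<close>

text \<open>Ordered pairs are summed, so a symmetric kernel counts each edge twice; the bound 3/10
  therefore appears as 3/5 until the final theorem.\<close>

definition quad :: "'a set \<Rightarrow> ('a \<Rightarrow> 'a \<Rightarrow> real) \<Rightarrow> ('a \<Rightarrow> real) \<Rightarrow> real" where
  "quad V K w = (\<Sum>u\<in>V. \<Sum>v\<in>V. K u v * w u * w v)"

text \<open>As the diagonal entry at \<open>v\<close> vanishes, the form is affine in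
  \<open>w v\<close>: row and column of \<open>v\<close> contribute equally, and the rest does not
  see \<open>w v\<close>.\<close>

lemma quad_remove:
  assumes "finite V" "v \<in> V" "\<And>u. K u v = K v u" "K v v = 0"
  shows "quad V K w = quad V K (w(v := 0)) + 2 * w v * (\<Sum>u\<in>V. K v u * w u)"
proof -
  let ?U = "V - {v}"
  have split: "quad V K y = 2 * (\<Sum>u\<in>?U. K v u * y v * y u) + (\<Sum>u\<in>?U. \<Sum>z\<in>?U. K u z * y u * y z)"
    for y :: "'a \<Rightarrow> real"
  proof -
    have "quad V K y = (\<Sum>z\<in>V. K v z * y v * y z) + (\<Sum>u\<in>?U. \<Sum>z\<in>V. K u z * y u * y z)"
      unfolding quad_def using assms(1,2) by (rule sum.remove)
    also have "(\<Sum>z\<in>V. K v z * y v * y z) = (\<Sum>u\<in>?U. K v u * y v * y u)"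
      using assms(1,2,4) by (simp add: sum.remove[of V v])
    also have "(\<Sum>u\<in>?U. \<Sum>z\<in>V. K u z * y u * y z)
        = (\<Sum>u\<in>?U. K v u * y v * y u) + (\<Sum>u\<in>?U. \<Sum>z\<in>?U. K u z * y u * y z)"
      using assms(1-3) by (simp add: sum.remove[of V v] sum.distrib mult_ac)
    finally show ?thesis by simp
  qed
  have "(\<Sum>u\<in>V. K v u * w u) = (\<Sum>u\<in>?U. K v u * w u)"
    using assms(1,2,4) by (simp add: sum.remove[of V v])
  moreover have "(\<Sum>u\<in>?U. \<Sum>z\<in>?U. K u z * (w(v := 0)) u * (w(v := 0)) z)
      = (\<Sum>u\<in>?U. \<Sum>z\<in>?U. K u z * w u * w z)"
    by (intro sum.cong) auto
  ultimately show ?thesis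
    using split[of w] split[of "w(v := 0)"] by (simp add: sum_distrib_left mult_ac)
qed

lemma quad_cong:
  assumes "\<And>u v. u \<in> V \<Longrightarrow> v \<in> V \<Longrightarrow> K u v * w u * w v = K' u v * w' u * w' v"
  shows "quad V K w = quad V K' w'"
  unfolding quad_def using assms by (intro sum.cong) auto

text \<open>If \<open>x\<close> gives the probabilities with which the vertices are independently put on one side of
  a cut, this is the probability that \<open>u\<close> and \<open>v\<close> end up on the same side (for \<open>u \<noteq> v\<close>).\<close>

definition same_side :: "('a \<Rightarrow> real) \<Rightarrow> 'a \<Rightarrow> 'a \<Rightarrow> real" where
  "same_side x u v = x u * x v + (1 - x u) * (1 - x v)"

text \<open>The difference of the two sides is a nonnegative combination of products of the slacks
  in the hypotheses, and vanishes at \<open>g = 4/5 * N\<close>, \<open>h = N/5\<close>. The term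
  \<open>5 * h * (g + h - N)\<close> can have either sign at a single vertex, but its weighted sum
  over all vertices is at most 0 by \<open>F_degree_sum_le\<close>.\<close>

lemma degree_region_inequality:
  fixes g h N :: real
  assumes "h \<le> g" "3/5 * N \<le> h + g / 2" "g + h / 2 \<le> 9/10 * N"
  shows "18 * N * h + 13 * N * g - 20 * g * h \<le> 54/5 * N\<^sup>2 + 5 * h * (g + h - N)"
proof -
  have "54/5 * N\<^sup>2 + 5 * h * (g + h - N) - (18 * N * h + 13 * N * g - 20 * g * h)
     = 40/3 * (9/10 * N - g - h/2)\<^sup>2 + 50/3 * ((9/10 * N - g - h/2) * (g - h))
       + 20/3 * ((h + g/2 - 3/5 * N) * (g - h))"
    by (simp add: field_simps power2_eq_square)
  also have "\<dots> \<ge> 0"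
    using assms by (intro add_nonneg_nonneg mult_nonneg_nonneg) auto
  finally show ?thesis by linarith
qed

section \<open>Weighted graphs with a triangle-independent set\<close>

text \<open>\<open>F_indep\<close> is triangle-independence: two \<open>F\<close>-edges meeting in
  \<open>x\<close> are never closed to a triangle of \<open>G\<close>. Equivalently,
  \<open>F\<close>-neighbourhoods are independent in \<open>G\<close>; the case \<open>u = v\<close>
  is irreflexivity.\<close>

locale triangle_independent_pair =
  fixes V :: "'a set" and G F :: "'a \<Rightarrow> 'a \<Rightarrow> bool"
  assumes finite_V: "finite V"
    and G_sym: "G u v \<longleftrightarrow> G v u"
    and F_sym: "F u v \<longleftrightarrow> F v u"
    and G_irrefl: "\<not> G u u"
    and F_imp_G: "F u v \<Longrightarrow> G u v"
    and F_indep: "F v x \<Longrightarrow> F x u \<Longrightarrow> \<not> G v u"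
begin

abbreviation deg :: "('a \<Rightarrow> 'a \<Rightarrow> bool) \<Rightarrow> ('a \<Rightarrow> real) \<Rightarrow> 'a \<Rightarrow> real" where
  "deg R w v \<equiv> \<Sum>u\<in>V. of_bool (R v u) * w u"

abbreviation edge_weight :: "('a \<Rightarrow> 'a \<Rightarrow> bool) \<Rightarrow> ('a \<Rightarrow> real) \<Rightarrow> real" where
  "edge_weight R w \<equiv> quad V (\<lambda>u v. of_bool (R u v)) w"

abbreviation uncut_weight :: "('a \<Rightarrow> real) \<Rightarrow> ('a \<Rightarrow> real) \<Rightarrow> real" where
  "uncut_weight x w \<equiv> quad V (\<lambda>u v. of_bool (G u v) * same_side x u v) w"

lemma edge_weight_eq: "edge_weight R w = (\<Sum>v\<in>V. w v * deg R w v)"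
  by (simp add: quad_def sum_distrib_left mult_ac)

section \<open>Changing one vertex of a fractional cut, and rounding\<close>

text \<open>The expected uncut weight is affine in the probability \<open>t\<close> of a single
  vertex. The two inner sums are the expected weights of the neighbours of \<open>v\<close> on the
  first and on the second side.\<close>

lemma uncut_weight_update:
  assumes "v \<in> V"
  shows "uncut_weight (x(v := t)) w = uncut_weight x (w(v := 0))
    + 2 * w v * (t * (\<Sum>u\<in>V. of_bool (G v u) * w u * x u)
                 + (1 - t) * (\<Sum>u\<in>V. of_bool (G v u) * w u * (1 - x u)))"
proof -
  let ?K = "\<lambda>u z. of_bool (G u z) * same_side (x(v := t)) u z"
  have "quad V ?K w = quad V ?K (w(v := 0)) + 2 * w v * (\<Sum>u\<in>V. ?K v u * w u)"
    using assms by (intro quad_remove) (auto simp: finite_V G_sym G_irrefl same_side_def)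
  moreover have "quad V ?K (w(v := 0)) = uncut_weight x (w(v := 0))"
    by (intro quad_cong) (auto simp: same_side_def)
  moreover have "(\<Sum>u\<in>V. ?K v u * w u)
      = t * (\<Sum>u\<in>V. of_bool (G v u) * w u * x u)
         + (1 - t) * (\<Sum>u\<in>V. of_bool (G v u) * w u * (1 - x u))"
    unfolding sum_distrib_left sum.distrib[symmetric]
    by (intro sum.cong) (auto simp: same_side_def G_irrefl algebra_simps)
  ultimately show ?thesis by simp
qed

text \<open>Method of conditional expectations: by affinity in each coordinate, the vertices can be
  moved one after another to an endpoint of [0, 1] without increasing the uncut weight.\<close>

lemma fractional_cut_rounding:
  assumes w: "\<And>v. v \<in> V \<Longrightarrow> 0 \<le> w v" and x: "\<And>v. v \<in> V \<Longrightarrow> 0 \<le> x v \<and> x v \<le> 1"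
  obtains y where "\<And>v. v \<in> V \<Longrightarrow> y v = 0 \<or> y v = 1" "uncut_weight y w \<le> uncut_weight x w"
proof -
  have "\<exists>y. (\<forall>v\<in>V. 0 \<le> y v \<and> y v \<le> 1) \<and> (\<forall>v\<in>S. y v = 0 \<or> y v = 1)
      \<and> uncut_weight y w \<le> uncut_weight x w" if "S \<subseteq> V" for S
    using finite_subset[OF that finite_V] that
  proof (induction S rule: finite_induct)
    case empty
    then show ?case using x by auto
  next
    case (insert v S)
    then obtain y where y: "\<forall>v\<in>V. 0 \<le> y v \<and> y v \<le> 1" "\<forall>v\<in>S. y v = 0 \<or> y v = 1"
      "uncut_weight y w \<le> uncut_weight x w" by auto
    have v: "v \<in> V" using insert by auto
    define a b c where "a = (\<Sum>u\<in>V. of_bool (G v u) * w u * y u)"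
      and "b = (\<Sum>u\<in>V. of_bool (G v u) * w u * (1 - y u))"
      and "c = uncut_weight y (w(v := 0))"
    have upd: "uncut_weight (y(v := t)) w = c + 2 * w v * (t * a + (1 - t) * b)" for t
      unfolding a_def b_def c_def by (rule uncut_weight_update[OF v])
    \<comment> \<open>The endpoint that minimises the affine function: \<open>v\<close> joins the
      side holding less weight of its neighbours.\<close>
    define t :: real where "t = (if a \<le> b then 1 else 0)"
    have "t * a + (1 - t) * b \<le> y v * a + (1 - y v) * b"
    proof -
      have "0 \<le> (1 - y v) * (b - a)" if "a \<le> b" using that y v by auto
      moreover have "0 \<le> y v * (a - b)" if "\<not> a \<le> b" using that y v by auto
      ultimately show ?thesis by (auto simp: t_def algebra_simps)
    qed
    then have "uncut_weight (y(v := t)) w \<le> uncut_weight (y(v := y v)) w"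
      unfolding upd using w[OF v] by (auto intro!: mult_left_mono)
    then have "uncut_weight (y(v := t)) w \<le> uncut_weight x w" using y(3) by simp
    moreover have "\<forall>z\<in>V. 0 \<le> (y(v := t)) z \<and> (y(v := t)) z \<le> 1"
      using y(1) by (simp add: t_def)
    moreover have "\<forall>z\<in>insert v S. (y(v := t)) z = 0 \<or> (y(v := t)) z = 1"
      using y(2) by (simp add: t_def)
    ultimately show ?case by blast
  qed
  from this[of V] show thesis using that by auto
qed

section \<open>Neighbourhood cuts when all degrees are large\<close>

text \<open>Two vertices outside the \<open>F\<close>-neighbourhood of \<open>v\<close> share a side
  with probability 1/36 + 25/36 = 13/18; one inside and one outside do so with probability 1/6 =
  13/18 - 5/9; no edge of \<open>G\<close> has both ends inside. The two corrections 5/9, one for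
  each end, have equal sums and give 10/9.\<close>

lemma uncut_weight_neighbourhood:
  "uncut_weight (\<lambda>u. if F v u then 1 else 1/6) w
     = 13/18 * edge_weight G w - 10/9 * (\<Sum>u\<in>V. of_bool (F v u) * w u * deg G w u)"
    (is "quad V ?K w = _")
proof -
  have "?K a b = 13/18 * of_bool (G a b)
      - 5/9 * (of_bool (F v a) * of_bool (G a b)) - 5/9 * (of_bool (F v b) * of_bool (G b a))" for a b
    using F_indep[of a v b] F_sym[of v a] F_sym[of v b] G_sym[of a b] by (auto simp: same_side_def)
  then have "quad V ?K w = (\<Sum>a\<in>V. \<Sum>b\<in>V. 13/18 * (of_bool (G a b) * w a * w b)
      - 5/9 * (of_bool (F v a) * w a * (of_bool (G a b) * w b))
      - 5/9 * (of_bool (F v b) * w b * (of_bool (G b a) * w a)))"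
    unfolding quad_def by (intro sum.cong refl) (simp only:, simp add: algebra_simps)
  also have "\<dots> = 13/18 * edge_weight G w
      - 5/9 * (\<Sum>a\<in>V. \<Sum>b\<in>V. of_bool (F v a) * w a * (of_bool (G a b) * w b))
      - 5/9 * (\<Sum>a\<in>V. \<Sum>b\<in>V. of_bool (F v b) * w b * (of_bool (G b a) * w a))"
    by (simp only: quad_def sum_subtractf sum_distrib_left)
  also have "(\<Sum>a\<in>V. \<Sum>b\<in>V. of_bool (F v b) * w b * (of_bool (G b a) * w a))
      = (\<Sum>a\<in>V. \<Sum>b\<in>V. of_bool (F v a) * w a * (of_bool (G a b) * w b))"
    by (rule sum.swap)
  finally have "quad V ?K w = 13/18 * edge_weight G w
      - 10/9 * (\<Sum>a\<in>V. \<Sum>b\<in>V. of_bool (F v a) * w a * (of_bool (G a b) * w b))"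
    by simp
  then show ?thesis by (simp only: sum_distrib_left)
qed

text \<open>By \<open>F_indep\<close>, no vertex is both a \<open>G\<close>-neighbour of
  \<open>v\<close> and an \<open>F\<close>-neighbour of \<open>x\<close>.\<close>

lemma deg_add_le:
  assumes "\<And>v. v \<in> V \<Longrightarrow> 0 \<le> w v" "F v x"
  shows "deg G w v + deg F w x \<le> sum w V"
  unfolding sum.distrib[symmetric]
  using assms F_indep[of v x] by (intro sum_mono) (auto simp: of_bool_def)

text \<open>Sum \<open>deg_add_le\<close> over all ordered \<open>F\<close>-pairs
  \<open>(v, x)\<close> with weight \<open>w v * w x\<close>. Exchanging the two ends replaces
  \<open>h x\<close> by \<open>h v\<close>.\<close>

lemma F_degree_sum_le:
  assumes "\<And>v. v \<in> V \<Longrightarrow> 0 \<le> w v"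
  shows "(\<Sum>v\<in>V. w v * (deg F w v * (deg G w v + deg F w v - sum w V))) \<le> 0"
proof -
  define g h where "g = deg G w" and "h = deg F w"
  let ?t = "\<lambda>c. \<Sum>v\<in>V. \<Sum>x\<in>V. of_bool (F v x) * w v * w x * c v x"
  have row: "?t (\<lambda>v x. c v) = (\<Sum>v\<in>V. w v * (h v * c v))" for c
    by (simp add: h_def sum_distrib_left sum_distrib_right mult_ac)
  have swap: "?t (\<lambda>v x. h x) = ?t (\<lambda>v x. h v)"
    by (subst sum.swap) (simp add: F_sym mult_ac)
  have "?t (\<lambda>v x. g v + h x - sum w V) \<le> 0"
  proof (intro sum_nonpos)
    fix v x assume "v \<in> V" "x \<in> V"
    then show "of_bool (F v x) * w v * w x * (g v + h x - sum w V) \<le> 0"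
      using deg_add_le[of w v x, OF assms] assms
      by (cases "F v x") (auto simp: g_def h_def intro!: mult_nonneg_nonpos)
  qed
  moreover have "?t (\<lambda>v x. g v + h x - sum w V)
      = ?t (\<lambda>v x. g v) + ?t (\<lambda>v x. h x) - ?t (\<lambda>v x. sum w V)"
    by (simp only: distrib_left right_diff_distrib sum.distrib sum_subtractf)
  moreover have "\<dots> = (\<Sum>v\<in>V. w v * (h v * (g v + h v - sum w V)))"
    unfolding swap row by (simp only: distrib_left right_diff_distrib sum.distrib sum_subtractf)
  ultimately show ?thesis unfolding g_def h_def by linarith
qed

text \<open>For the second bound, \<open>deg G w v\<close> is at most the total weight, so the
  degree hypothesis forces an \<open>F\<close>-neighbour \<open>x\<close> of positive weight. Add
  \<open>deg_add_le\<close> for \<open>(v, x)\<close> to half of it for \<open>(x, v)\<close> and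
  subtract the degree hypothesis at \<open>x\<close>: 3/2 - 3/5 = 9/10.\<close>

lemma degree_region:
  assumes w: "\<And>v. v \<in> V \<Longrightarrow> 0 \<le> w v" and N: "0 < sum w V"
    and deg: "\<And>v. v \<in> V \<Longrightarrow> 0 < w v \<Longrightarrow> 3/5 * sum w V < deg F w v + deg G w v / 2"
    and v: "v \<in> V" "0 < w v"
  shows "deg F w v \<le> deg G w v" "deg G w v + deg F w v / 2 \<le> 9/10 * sum w V"
proof -
  show "deg F w v \<le> deg G w v"
    using w F_imp_G by (intro sum_mono) (auto simp: of_bool_def)
  have "deg G w v \<le> sum w V"
    using w by (intro sum_mono) (auto simp: of_bool_def)
  then have "0 < deg F w v" using deg[OF v] N by linarith
  then obtain x where "x \<in> V" "0 < of_bool (F v x) * w x"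
    by (meson not_less sum_nonpos)
  then have x: "x \<in> V" "F v x" "0 < w x" by (auto simp: of_bool_def split: if_splits)
  have "deg G w v + deg F w x \<le> sum w V" "deg G w x + deg F w v \<le> sum w V"
    using deg_add_le[of w v x, OF w] deg_add_le[of w x v, OF w] x F_sym by auto
  then show "deg G w v + deg F w v / 2 \<le> 9/10 * sum w V"
    using deg[OF x(1,3)] by linarith
qed

text \<open>In the average over \<open>v\<close> with weights \<open>w v\<close>, symmetry of
  \<open>F\<close> turns the double sum into single-vertex terms in \<open>g\<close> and
  \<open>h\<close>, to which \<open>degree_region_inequality\<close> applies.\<close>

lemma exists_cut_large_degrees:
  assumes w: "\<And>v. v \<in> V \<Longrightarrow> 0 \<le> w v" and N: "0 < sum w V"
    and deg: "\<And>v. v \<in> V \<Longrightarrow> 0 < w v \<Longrightarrow> 3/5 * sum w V < deg F w v + deg G w v / 2"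
  obtains v where "edge_weight F w + uncut_weight (\<lambda>u. if F v u then 1 else 1/6) w
    \<le> 3/5 * (sum w V)\<^sup>2"
proof -
  define g h N where "g = deg G w" and "h = deg F w" and "N = sum w V"
  define s where "s v = (\<Sum>u\<in>V. of_bool (F v u) * w u * g u)" for v
  define c where "c v = edge_weight F w + uncut_weight (\<lambda>u. if F v u then 1 else 1/6) w" for v
  have c: "c v = (\<Sum>u\<in>V. w u * (h u + 13/18 * g u)) - 10/9 * s v" for v
    unfolding c_def uncut_weight_neighbourhood edge_weight_eq s_def g_def h_def
    by (simp only: distrib_left sum.distrib sum_distrib_left mult.left_commute[of _ "13/18"])
  have "(\<Sum>v\<in>V. w v * s v) = (\<Sum>u\<in>V. \<Sum>v\<in>V. w v * (of_bool (F v u) * w u * g u))"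
    unfolding s_def sum_distrib_left by (rule sum.swap)
  also have "\<dots> = (\<Sum>u\<in>V. w u * (g u * h u))"
    by (simp add: h_def F_sym sum_distrib_left mult_ac)
  finally have s: "(\<Sum>v\<in>V. w v * s v) = (\<Sum>u\<in>V. w u * (g u * h u))" .
  have "(\<Sum>v\<in>V. w v * c v) = N * (\<Sum>u\<in>V. w u * (h u + 13/18 * g u)) - 10/9 * (\<Sum>v\<in>V. w v * s v)"
    unfolding c right_diff_distrib sum_subtractf sum_distrib_right[symmetric] N_def[symmetric]
    by (simp add: sum_distrib_left mult_ac)
  also have "\<dots> = (\<Sum>v\<in>V. w v * ((18 * N * h v + 13 * N * g v - 20 * g v * h v) / 18))"
    unfolding s sum_distrib_left sum_subtractf[symmetric]
    by (intro sum.cong) (auto simp: field_simps)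
  also have "\<dots> \<le> (\<Sum>v\<in>V. w v * ((54/5 * N\<^sup>2 + 5 * h v * (g v + h v - N)) / 18))"
  proof (intro sum_mono)
    fix v assume v: "v \<in> V"
    show "w v * ((18 * N * h v + 13 * N * g v - 20 * g v * h v) / 18)
        \<le> w v * ((54/5 * N\<^sup>2 + 5 * h v * (g v + h v - N)) / 18)"
    \<comment> \<open>The degree hypothesis says nothing about vertices of weight 0, but both sides
      vanish there.\<close>
    proof (cases "w v = 0")
      case False
      then have pos: "0 < w v" using w[OF v] by simp
      have "18 * N * h v + 13 * N * g v - 20 * g v * h v \<le> 54/5 * N\<^sup>2 + 5 * h v * (g v + h v - N)"
        using degree_region[of w v, OF w \<open>0 < sum w V\<close> deg v pos] deg[OF v pos]
        by (intro degree_region_inequality) (auto simp: g_def h_def N_def)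
      then show ?thesis using pos by (intro mult_left_mono divide_right_mono) auto
    qed simp
  qed
  \<comment> \<open>Here 54/5 divided by 18 is 3/5, and the second sum is the one bounded by
    \<open>F_degree_sum_le\<close>.\<close>
  also have "\<dots> = (\<Sum>v\<in>V. w v * (3/5 * N\<^sup>2)) + 5/18 * (\<Sum>v\<in>V. w v * (h v * (g v + h v - N)))"
    unfolding sum_distrib_left sum.distrib[symmetric]
    by (intro sum.cong) (auto simp: field_simps)
  also have "\<dots> \<le> (\<Sum>v\<in>V. w v * (3/5 * N\<^sup>2))"
    using F_degree_sum_le[of w, OF w] by (simp add: g_def h_def N_def)
  finally have avg: "(\<Sum>v\<in>V. w v * (c v - 3/5 * N\<^sup>2)) \<le> 0"
    by (simp add: right_diff_distrib sum_subtractf)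
  have "\<exists>v. c v \<le> 3/5 * N\<^sup>2"
  \<comment> \<open>Some vertex has positive weight, so excesses that are all positive would make
    the weighted sum positive.\<close>
  proof (rule ccontr)
    assume "\<nexists>v. c v \<le> 3/5 * N\<^sup>2"
    then have big: "0 < c v - 3/5 * N\<^sup>2" for v by (simp add: not_le)
    obtain v where v: "v \<in> V" "0 < w v"
      using \<open>0 < sum w V\<close> by (meson not_less sum_nonpos)
    have "0 < (\<Sum>v\<in>V. w v * (c v - 3/5 * N\<^sup>2))"
      using w v big less_imp_le[OF big] by (intro sum_pos2[OF finite_V v(1)]) auto
    then show False using avg by simp
  qed
  then show thesis using that unfolding c_def N_def by auto
qed

section \<open>Induction on the total weight\<close>

text \<open>Weights are natural numbers so that single units can be removed. Restoring a unit at a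
  vertex of low degree costs at most \<open>2 * deg F w v + deg G w v\<close>, which is at most 6/5
  of the total weight \<open>N\<close>. The linear term in the bound makes it grow by exactly
  \<open>6/5 * N\<close> from \<open>N - 1\<close> to \<open>N\<close>.\<close>

lemma exists_fractional_cut:
  fixes m :: "'a \<Rightarrow> nat"
  shows "\<exists>x. (\<forall>v\<in>V. 0 \<le> x v \<and> x v \<le> 1) \<and>
    edge_weight F (\<lambda>v. real (m v)) + uncut_weight x (\<lambda>v. real (m v))
      \<le> 3/5 * ((real (sum m V))\<^sup>2 + real (sum m V))"
proof (induction "sum m V" arbitrary: m rule: less_induct)
  case less
  define w where "w v = real (m v)" for v
  have sum_w: "sum w V = real (sum m V)" by (simp add: w_def)
  have w: "0 \<le> w v" for v by (simp add: w_def)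
  consider (zero) "sum m V = 0"
    | (low) v where "v \<in> V" "0 < m v" "deg F w v + deg G w v / 2 \<le> 3/5 * sum w V"
    | (high) "0 < sum w V" "\<And>v. v \<in> V \<Longrightarrow> 0 < w v \<Longrightarrow> 3/5 * sum w V < deg F w v + deg G w v / 2"
  proof (cases "\<exists>v\<in>V. 0 < m v \<and> deg F w v + deg G w v / 2 \<le> 3/5 * sum w V")
    case True
    then show thesis using low by blast
  next
    case False
    then have "3/5 * sum w V < deg F w v + deg G w v / 2" if "v \<in> V" "0 < w v" for v
      using that by (auto simp: w_def not_le)
    moreover have "sum m V = 0 \<or> 0 < sum w V" unfolding sum_w by linarith
    ultimately show thesis using zero high by blast
  qed
  then show ?case
  proof cases
    case zero
    then have "edge_weight F w = 0" "uncut_weight (\<lambda>_. 0) w = 0"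
      using finite_V by (auto simp: quad_def w_def)
    with zero show ?thesis unfolding w_def by (intro exI[of _ "\<lambda>_. 0"]) simp
  next
    case high
    from w high obtain v where "edge_weight F w + uncut_weight (\<lambda>u. if F v u then 1 else 1/6) w
        \<le> 3/5 * (sum w V)\<^sup>2" by (rule exists_cut_large_degrees)
    also have "\<dots> \<le> 3/5 * ((real (sum m V))\<^sup>2 + real (sum m V))"
      unfolding sum_w by (simp add: sum_nonneg)
    finally show ?thesis unfolding w_def
      by (intro exI[of _ "\<lambda>u. if F v u then 1 else 1/6"]) simp
  next
    case low
    define m' where "m' = m(v := m v - 1)"
    define w' where "w' u = real (m' u)" for u
    have w': "w' = w(v := w v - 1)" using low by (auto simp: w'_def m'_def w_def)
    have "sum m V = m v + sum m (V - {v})" "sum m' V = m' v + sum m' (V - {v})"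
      using low finite_V by (simp_all add: sum.remove[of V v])
    moreover have "sum m' (V - {v}) = sum m (V - {v})" by (intro sum.cong) (auto simp: m'_def)
    ultimately have sum_m: "sum m V = Suc (sum m' V)" using low by (simp add: m'_def)
    with less[of m'] obtain x where x: "\<forall>v\<in>V. 0 \<le> x v \<and> x v \<le> 1"
      "edge_weight F w' + uncut_weight x w' \<le> 3/5 * ((real (sum m' V))\<^sup>2 + real (sum m' V))"
      unfolding w'_def by auto
    have upd0: "w'(v := 0) = w(v := 0)" by (simp add: w')
    have irrefl: "\<not> F v v" using F_imp_G G_irrefl by blast
    have nbr: "(\<Sum>u\<in>V. of_bool (R v u) * w' u * y u) = (\<Sum>u\<in>V. of_bool (R v u) * w u * y u)"
      if "\<not> R v v" for R and y :: "'a \<Rightarrow> real"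
      using that by (intro sum.cong) (auto simp: w')
    \<comment> \<open>The weights \<open>w\<close> and \<open>w'\<close> agree away from
      \<open>v\<close>, so subtracting the two decompositions leaves only the contribution of the
      one unit at \<open>v\<close>.\<close>
    have "edge_weight F z = edge_weight F (z(v := 0)) + 2 * z v * deg F z v" for z
      using low irrefl F_sym finite_V by (intro quad_remove) auto
    from this[of w] this[of w']
    have "edge_weight F w - 2 * w v * deg F w v = edge_weight F w' - 2 * w' v * deg F w' v"
      by (simp only: upd0)
    moreover have "deg F w' v = deg F w v" using nbr[of F "\<lambda>_. 1"] irrefl by simp
    ultimately have F_drop: "edge_weight F w = edge_weight F w' + 2 * deg F w v"
      by (simp add: w' algebra_simps)
    define a b c where "a = (\<Sum>u\<in>V. of_bool (G v u) * w u * x u)"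
      and "b = (\<Sum>u\<in>V. of_bool (G v u) * w u * (1 - x u))"
      and "c = uncut_weight x (w(v := 0))"
    have ab: "a + b = deg G w v"
      unfolding a_def b_def sum.distrib[symmetric] by (simp add: algebra_simps)
    have upd: "uncut_weight (x(v := t)) w = c + 2 * w v * (t * a + (1 - t) * b)" for t
      unfolding a_def b_def c_def by (rule uncut_weight_update[OF low(1)])
    have "uncut_weight (x(v := t)) w' = c + 2 * w' v * (t * a + (1 - t) * b)" for t
      unfolding a_def b_def c_def
      using uncut_weight_update[OF low(1), of x t w'] by (simp add: nbr[of G, OF G_irrefl] upd0)
    from this[of "x v"]
    have old: "uncut_weight x w' = c + 2 * (w v - 1) * (x v * a + (1 - x v) * b)" by (simp add: w')
    text \<open>Move \<open>v\<close> to the other side if the cut for \<open>w'\<close> has more than half of its neighbours on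
      its own side.\<close>
    have "\<exists>t. 0 \<le> t \<and> t \<le> 1 \<and> uncut_weight (x(v := t)) w \<le> uncut_weight x w' + deg G w v"
    proof -
      \<comment> \<open>\<open>d\<close> is the expected weight of the neighbours of
        \<open>v\<close> on its own side. Without a move the new unit adds \<open>2 * d\<close>; the
        flip also moves the \<open>w v - 1\<close> old units, whose gain enters the last product in
        \<open>flip\<close>.\<close>
      define d where "d = x v * a + (1 - x v) * b"
      have keep: "uncut_weight (x(v := x v)) w = uncut_weight x w' + 2 * d"
        unfolding upd old d_def by (simp add: algebra_simps)
      have flip: "uncut_weight (x(v := 1 - x v)) w
          = uncut_weight x w' + deg G w v - (2 * w v - 1) * (2 * d - deg G w v)"
        unfolding upd old d_def ab[symmetric] by (simp add: algebra_simps)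
      have xv: "0 \<le> x v" "x v \<le> 1" using x low by auto
      show ?thesis
      proof (cases "deg G w v \<le> 2 * d")
        case True
        moreover have "1 \<le> w v" using low by (simp add: w_def)
        ultimately have "0 \<le> (2 * w v - 1) * (2 * d - deg G w v)" by simp
        then show ?thesis using flip xv by (intro exI[of _ "1 - x v"]) simp
      next
        case False
        then show ?thesis using keep xv by (intro exI[of _ "x v"]) simp
      qed
    qed
    then obtain t where t: "0 \<le> t" "t \<le> 1"
      "uncut_weight (x(v := t)) w \<le> uncut_weight x w' + deg G w v" by auto
    have "edge_weight F w + uncut_weight (x(v := t)) w
        \<le> 3/5 * ((real (sum m' V))\<^sup>2 + real (sum m' V)) + 6/5 * real (sum m V)"
      using F_drop t(3) x(2) low(3) unfolding sum_w by linarith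
    also have "\<dots> = 3/5 * ((real (sum m V))\<^sup>2 + real (sum m V))"
      by (simp add: sum_m power2_eq_square field_simps)
    finally show ?thesis
      using x(1) t unfolding w_def by (intro exI[of _ "x(v := t)"]) auto
  qed
qed

text \<open>Constant weight \<open>k\<close> is the \<open>k\<close>-fold blow-up: the quadratic
  forms scale by the square of \<open>k\<close>, the error term only by \<open>k\<close>. Rounding
  then makes the cut integral.\<close>

lemma exists_cut:
  obtains y where "\<And>v. v \<in> V \<Longrightarrow> y v = 0 \<or> y v = 1"
    "(real k)\<^sup>2 * ((\<Sum>u\<in>V. \<Sum>v\<in>V. of_bool (F u v))
        + (\<Sum>u\<in>V. \<Sum>v\<in>V. of_bool (G u v) * same_side y u v))
      \<le> 3/5 * ((real (k * card V))\<^sup>2 + real (k * card V))"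
proof -
  obtain x where x: "\<forall>v\<in>V. 0 \<le> x v \<and> x v \<le> 1"
    "edge_weight F (\<lambda>_. real k) + uncut_weight x (\<lambda>_. real k)
      \<le> 3/5 * ((real (k * card V))\<^sup>2 + real (k * card V))"
    using exists_fractional_cut[of "\<lambda>_. k"] by (auto simp: mult_ac)
  obtain y where y: "\<And>v. v \<in> V \<Longrightarrow> y v = 0 \<or> y v = 1"
    "uncut_weight y (\<lambda>_. real k) \<le> uncut_weight x (\<lambda>_. real k)"
    using fractional_cut_rounding[of "\<lambda>_. real k" x] x(1) by auto
  have const: "quad V K (\<lambda>_. real k) = (real k)\<^sup>2 * (\<Sum>u\<in>V. \<Sum>v\<in>V. K u v)" for K
    by (simp add: quad_def sum_distrib_left power2_eq_square mult_ac)
  show thesis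
    using that[OF y(1)] x(2) y(2) unfolding const by (simp add: distrib_left)
qed

end

section \<open>Translation to sets of edges\<close>

lemma sum_edges_ordered:
  assumes "finite V" "D \<subseteq> nsets V 2"
  shows "(\<Sum>u\<in>V. \<Sum>v\<in>V. of_bool ({u, v} \<in> D)) = 2 * real (card D)"
proof -
  have fin: "finite D" using assms finite_imp_finite_nsets finite_subset by blast
  have "(\<Sum>u\<in>V. \<Sum>v\<in>V. of_bool ({u, v} \<in> D)) = (\<Sum>u\<in>V. \<Sum>v\<in>V. \<Sum>e\<in>D. of_bool (e = {u, v}) :: real)"
    using fin by (simp add: of_bool_def sum.delta)
  also have "\<dots> = (\<Sum>u\<in>V. \<Sum>e\<in>D. \<Sum>v\<in>V. of_bool (e = {u, v}))"
    by (intro sum.cong refl sum.swap)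
  also have "\<dots> = (\<Sum>e\<in>D. \<Sum>u\<in>V. \<Sum>v\<in>V. of_bool (e = {u, v}))"
    by (rule sum.swap)
  also have "\<dots> = (\<Sum>e\<in>D. 2)"
  proof (rule sum.cong[OF refl])
    fix e assume "e \<in> D"
    then obtain a b where e: "e = {a, b}" "a \<noteq> b" "a \<in> V" "b \<in> V"
      using assms(2) by (auto simp: nsets_def card_2_iff)
    \<comment> \<open>The edge arises from exactly two ordered pairs, \<open>(a, b)\<close> and
      \<open>(b, a)\<close>.\<close>
    have "(\<Sum>v\<in>V. of_bool (e = {u, v})) = of_bool (u = a) + (of_bool (u = b) :: real)" for u
    proof -
      have "(\<Sum>v\<in>V. of_bool (e = {u, v}))
          = (\<Sum>v\<in>V. (if v = b then of_bool (u = a) else 0) + (if v = a then of_bool (u = b) else 0) :: real)"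
        using e by (intro sum.cong) (auto simp: doubleton_eq_iff)
      then show ?thesis using e assms(1) by (simp add: sum.distrib sum.delta)
    qed
    then show "(\<Sum>u\<in>V. \<Sum>v\<in>V. of_bool (e = {u, v})) = (2::real)"
      using e assms(1) by (simp add: sum.distrib of_bool_def sum.delta)
  qed
  finally show ?thesis by simp
qed

lemma triangle_independent_imp_pair:
  assumes "simple_graph V E" "triangle_independent E A"
  shows "triangle_independent_pair V (\<lambda>u v. {u, v} \<in> E) (\<lambda>u v. {u, v} \<in> A)"
proof
  have AE: "A \<subseteq> E" using assms by (simp add: triangle_independent_def)
  show "finite V" using assms by (simp add: simple_graph_def)
  show irrefl: "{u, u} \<notin> E" for u using assms by (auto simp: simple_graph_def nsets_def)
  show "{u, v} \<in> A \<Longrightarrow> {u, v} \<in> E" for u v using AE by auto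
  show "{v, u} \<notin> E" if "{v, x} \<in> A" "{x, u} \<in> A" for v x u
  proof
    assume vu: "{v, u} \<in> E"
    \<comment> \<open>A coincidence of two of these vertices would make one of the three edges a
      loop.\<close>
    have dist: "distinct [v, x, u]" using that vu AE irrefl by auto
    let ?T = "{{v, x}, {x, u}, {v, u}}"
    have "?T \<in> triangles E" unfolding triangles_def using dist that vu AE by blast
    then have "card (A \<inter> ?T) \<le> 1" using assms by (simp add: triangle_independent_def)
    moreover have "card {{v, x}, {x, u}} \<le> card (A \<inter> ?T)"
      using that by (intro card_mono) auto
    moreover have "card {{v, x}, {x, u}} = 2" using dist by (auto simp: doubleton_eq_iff)
    ultimately show False by simp
  qed
qed (simp_all add: insert_commute)

text \<open>For values 0 and 1, \<open>same_side y u v\<close> is the indicator of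
  \<open>y u = y v\<close>. Deleting the edges inside the two classes leaves a bipartite graph, and
  the double sum counts each deleted edge twice.\<close>

lemma tau_B_le_same_side:
  assumes "simple_graph V E" and y: "\<And>v. v \<in> V \<Longrightarrow> y v = 0 \<or> y v = 1"
  shows "2 * real (tau_B V E) \<le> (\<Sum>u\<in>V. \<Sum>v\<in>V. of_bool ({u, v} \<in> E) * same_side y u v)"
proof -
  define D where "D = {e \<in> E. \<forall>u\<in>e. \<forall>v\<in>e. y u = y v}"
  have E: "E \<subseteq> nsets V 2" "finite V" "finite E"
    using assms(1) simple_graph_finite_edges by (auto simp: simple_graph_def)
  have "bipartite V (E - D)"
    unfolding bipartite_def
  proof (intro exI conjI ballI)
    let ?X = "{v \<in> V. y v = 1}" and ?Y = "{v \<in> V. y v = 0}"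
    show "?X \<union> ?Y = V" using y by auto
    show "?X \<inter> ?Y = {}" by auto
    fix e assume e: "e \<in> E - D"
    then obtain a b where ab: "e = {a, b}" "a \<in> V" "b \<in> V"
      using E(1) by (auto simp: nsets_def card_2_iff)
    then have "y a \<noteq> y b" using e by (auto simp: D_def)
    then consider "a \<in> ?X" "b \<in> ?Y" | "b \<in> ?X" "a \<in> ?Y" using y[of a] y[of b] ab by auto
    then show "\<exists>x\<in>?X. \<exists>y\<in>?Y. e = {x, y}"
      using ab(1) insert_commute[of a b "{}"] by cases blast+
  qed
  then have "tau_B V E \<le> card D"
    unfolding tau_B_def using tau_B_attained(1)[OF E(3), of V]
    by (intro Min_le) (auto simp: D_def)
  moreover have "2 * real (card D) = (\<Sum>u\<in>V. \<Sum>v\<in>V. of_bool ({u, v} \<in> D))"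
    using E by (intro sum_edges_ordered[symmetric]) (auto simp: D_def)
  moreover have "\<dots> = (\<Sum>u\<in>V. \<Sum>v\<in>V. of_bool ({u, v} \<in> E) * same_side y u v)"
  proof (intro sum.cong refl)
    fix u v assume "u \<in> V" "v \<in> V"
    then have "y u = 0 \<or> y u = 1" "y v = 0 \<or> y v = 1" using y by auto
    moreover have "{u, v} \<in> D \<longleftrightarrow> {u, v} \<in> E \<and> y u = y v"
      by (simp add: D_def) metis
    ultimately show "of_bool ({u, v} \<in> D) = of_bool ({u, v} \<in> E) * same_side y u v"
      by (auto simp: same_side_def)
  qed
  ultimately show ?thesis by simp
qed

section \<open>Limit of large blow-ups\<close>

theorem theorem3p5:
  fixes V :: "'a set" and E :: "'a set set" and n :: nat
  assumes "simple_graph V E" and "card V = n"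
  shows "real (alpha_1 E) + real (tau_B V E) \<le> 3 * (real n)\<^sup>2 / 10"
proof -
  have E: "E \<subseteq> nsets V 2" "finite V" "finite E"
    using assms(1) simple_graph_finite_edges by (auto simp: simple_graph_def)
  have "alpha_1 E \<in> {card A | A. triangle_independent E A}"
    unfolding alpha_1_def using alpha_1_attained[OF E(3)] by (rule Max_in)
  then obtain A where A: "triangle_independent E A" "alpha_1 E = card A" by auto
  interpret triangle_independent_pair V "\<lambda>u v. {u, v} \<in> E" "\<lambda>u v. {u, v} \<in> A"
    using assms(1) A(1) by (rule triangle_independent_imp_pair)
  have "A \<subseteq> nsets V 2" using A(1) E(1) by (auto simp: triangle_independent_def)
  then have cardA: "(\<Sum>u\<in>V. \<Sum>v\<in>V. of_bool ({u, v} \<in> A)) = 2 * real (alpha_1 E)"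
    using sum_edges_ordered[OF E(2)] A(2) by simp
  define c where "c = real (alpha_1 E) + real (tau_B V E)"
  \<comment> \<open>Blow up by \<open>Suc j\<close>, which is positive, and divide by its square:
    the linear error shrinks to a multiple of \<open>inverse (real (Suc j))\<close>, while
    \<open>c\<close> does not depend on \<open>j\<close>.\<close>
  have bound: "c \<le> 3/10 * (real n)\<^sup>2 + 3/10 * real n * inverse (real (Suc j))" for j
  proof -
    define k where "k = Suc j"
    obtain y where y: "\<And>v. v \<in> V \<Longrightarrow> y v = 0 \<or> y v = 1"
      "(real k)\<^sup>2 * (2 * real (alpha_1 E)
          + (\<Sum>u\<in>V. \<Sum>v\<in>V. of_bool ({u, v} \<in> E) * same_side y u v))
        \<le> 3/5 * ((real (k * n))\<^sup>2 + real (k * n))"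
      using exists_cut[of k] unfolding cardA assms(2) by blast
    have "(real k)\<^sup>2 * (2 * c) \<le> (real k)\<^sup>2 * (2 * real (alpha_1 E)
          + (\<Sum>u\<in>V. \<Sum>v\<in>V. of_bool ({u, v} \<in> E) * same_side y u v))"
      using tau_B_le_same_side[OF assms(1) y(1)] by (intro mult_left_mono) (auto simp: c_def)
    also note y(2)
    also have "3/5 * ((real (k * n))\<^sup>2 + real (k * n))
        = (real k)\<^sup>2 * (2 * (3/10 * (real n)\<^sup>2 + 3/10 * real n * inverse (real k)))"
      by (simp add: k_def field_simps power2_eq_square)
    finally have "2 * c \<le> 2 * (3/10 * (real n)\<^sup>2 + 3/10 * real n * inverse (real k))"
      by (simp only: mult_le_cancel_left_pos k_def zero_less_power of_nat_0_less_iff zero_less_Suc)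
    then show ?thesis by (simp add: k_def)
  qed
  have "(\<lambda>j. 3/10 * (real n)\<^sup>2 + 3/10 * real n * inverse (real (Suc j)))
      \<longlonglongrightarrow> 3/10 * (real n)\<^sup>2 + 3/10 * real n * 0"
    by (intro tendsto_intros LIMSEQ_inverse_real_of_nat)
  then have "c \<le> 3/10 * (real n)\<^sup>2 + 3/10 * real n * 0"
    by (rule LIMSEQ_le_const) (use bound in auto)
  then show ?thesis by (simp add: c_def)
qed

end
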